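(* Let $q\in\mathbb{C}$ with $0<|q|<1$ and let $n\ge0$ be an integer. Then $$\sum_{k=0}^{\lfloor n/2\rfloor}\mathcal{U}_{n}^{k}=\left(\left\lfloor\frac n2\right\rfloor-\frac n2+1\right)\mathcal{U}_{n}+\frac x2\,\frac{d\,\mathcal{U}_{n}}{dx},$$ where $\mathcal{U}_n=\mathcal{U}_n(x,s,q)$ is the $q$-Chebyshev polynomial of the second kind and $\mathcal{U}_n^k=\mathcal{U}_n^k(x,s,q)$ are the incomplete $q$-Chebyshev polynomials of the second kind.
   Context: Notation: $(a;q)_0=1$ and $(a;q)_n=\prod_{i=0}^{n-1}(1-q^i a)$; $\begin{bmatrix} n\\k\end{bmatrix}_q=\frac{(q;q)_n}{(q;q)_{n-k}(q;q)_k}$ for $0\le k\le n$, and it is $0$ for $n<k$. Here $x,s$ are indeterminates. The $q$-Chebyshev polynomials of the second kind are defined by $\mathcal{U}_0=1$, $\mathcal{U}_1=(1+q)x$, $\mathcal{U}_{n}=(1+q^{n})x\,\mathcal{U}_{n-1}+q^{n-1}s\,\mathcal{U}_{n-2}$ for $n\ge2$; it is known that $$\mathcal{U}_n(x,s,q)=\sum_{j=0}^{\lfloor n/2\rfloor}q^{j^2}\begin{bmatrix} n-j\\ j\end{bmatrix}_q\frac{(-q;q)_{n-j}}{(-q;q)_j}\,s^jx^{n-2j}\qquad(n\ge0).$$ For $0\le k\le\lfloor n/2\rfloor$, the incomplete $q$-Chebyshev polynomials of the second kind are $$\mathcal{U}_n^k(x,s,q)=\sum_{j=0}^{k}q^{j^2}\begin{bmatrix}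 n-j\\ j\end{bmatrix}_q\frac{(-q;q)_{n-j}}{(-q;q)_j}\,s^jx^{n-2j}.$$ *)

theory Defs
  imports Complex_Main "HOL-Computational_Algebra.Polynomial"
begin

definition q_pochhammer :: "'a::comm_ring_1 \<Rightarrow> 'a \<Rightarrow> nat \<Rightarrow> 'a" where
  "q_pochhammer a q n = (\<Prod>i<n. 1 - q ^ i * a)"

definition q_binomial :: "'a::field \<Rightarrow> nat \<Rightarrow> nat \<Rightarrow> 'a" where
  "q_binomial q n k =
     (if k \<le> n then q_pochhammer q q n / (q_pochhammer q q (n - k) * q_pochhammer q q k) else 0)"

text \<open>
  Polynomials in the two indeterminates \<open>x\<close> and \<open>s\<close> are rendered as polynomials in \<open>x\<close>
  whose coefficients are polynomials in \<open>s\<close>; thus the partial derivative with respect to \<open>x\<close>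
  is \<^const>\<open>pderiv\<close>.
\<close>

definition x_var :: "complex poly poly" where
  "x_var = [:0, 1:]"

definition s_var :: "complex poly poly" where
  "s_var = [:[:0, 1:]:]"

definition scalar :: "complex \<Rightarrow> complex poly poly" where
  "scalar c = [:[:c:]:]"

fun q_cheb_U :: "complex \<Rightarrow> nat \<Rightarrow> complex poly poly" where
  "q_cheb_U q 0 = 1"
| "q_cheb_U q (Suc 0) = scalar (1 + q) * x_var"
| "q_cheb_U q (Suc (Suc n)) =
     scalar (1 + q ^ (n + 2)) * x_var * q_cheb_U q (Suc n)
     + scalar (q ^ (n + 1)) * s_var * q_cheb_U q n"

text \<open>
  The superscript \<open>k\<close> of the incomplete polynomial is the second numerical argument; it is meant
  to be used for \<open>k \<le> n div 2\<close> only (so that the exponent \<open>n - 2 * j\<close> is never truncated).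
\<close>

definition inc_q_cheb_U :: "complex \<Rightarrow> nat \<Rightarrow> nat \<Rightarrow> complex poly poly" where
  "inc_q_cheb_U q n k =
     (\<Sum>j\<le>k. scalar (q ^ (j\<^sup>2) * q_binomial q (n - j) j
                * (q_pochhammer (- q) q (n - j) / q_pochhammer (- q) q j))
            * s_var ^ j * x_var ^ (n - 2 * j))"

end

theory Submission
  imports Defs
begin

text \<open>
  Both sides are combinations of the monomials of \<open>U\<^sub>n\<close>, and the identity compares multiplicities.
  On the left, the \<open>j\<close>-th term of \<open>U\<^sub>n\<close> occurs in \<open>U\<^sub>n\<^sup>k\<close> exactly for \<open>j \<le> k \<le> \<lfloor>n/2\<rfloor>\<close>, hence
  \<open>\<lfloor>n/2\<rfloor> + 1 - j\<close> times. On the right, the Euler operator \<open>x d/dx\<close> multiplies this term by its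
  \<open>x\<close>-degree \<open>n - 2j\<close>, and \<open>\<lfloor>n/2\<rfloor> - n/2 + 1 + (n - 2j)/2\<close> is the same number.

  What remains is the explicit formula for the recursively defined \<open>U\<^sub>n\<close>
  (\<open>q_cheb_U_eq_inc\<close>). Its coefficients satisfy the three-term recurrence
  \<open>cheb_coeff_Suc_Suc\<close>, which is the sum of the first \<open>q\<close>-Pascal rule and \<open>q\<^sup>m\<close> times the second
  one for the upper index \<open>m\<close>. All denominators are products of factors \<open>1 - q\<^sup>i\<close> and \<open>1 + q\<^sup>i\<close> with
  \<open>i > 0\<close>, which do not vanish because no positive power of \<open>q\<close> equals \<open>1\<close>.
\<close>

section \<open>The q-Pascal rules\<close>

lemma q_pochhammer_0 [simp]: "q_pochhammer a q 0 = 1"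
  by (simp add: q_pochhammer_def)

lemma q_pochhammer_Suc: "q_pochhammer a q (Suc n) = q_pochhammer a q n * (1 - q ^ n * a)"
  by (simp add: q_pochhammer_def)

lemma q_pochhammer_self_nonzero:
  fixes q :: "'a::field"
  assumes "\<And>k. k > 0 \<Longrightarrow> q ^ k \<noteq> 1"
  shows "q_pochhammer q q n \<noteq> 0"
proof -
  have "1 - q ^ i * q \<noteq> 0" for i
    using assms[of "Suc i"] by (simp add: mult.commute)
  then show ?thesis by (simp add: q_pochhammer_def)
qed

lemma q_pochhammer_neg_nonzero:
  fixes q :: "'a::field"
  assumes "\<And>k. k > 0 \<Longrightarrow> q ^ k \<noteq> 1"
  shows "q_pochhammer (- q) q n \<noteq> 0"
proof -
  have "1 + q ^ i * q \<noteq> 0" for i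
  proof
    assume "1 + q ^ i * q = 0"
    then have "q ^ Suc i = - 1"
      by (simp add: add_eq_0_iff mult.commute)
    then have "(q ^ Suc i)\<^sup>2 = 1" by simp
    then have "q ^ (Suc i * 2) = 1" by (simp only: power_mult)
    then show False using assms[of "Suc i * 2"] by simp
  qed
  then show ?thesis by (simp add: q_pochhammer_def)
qed

lemma q_binomial_0:
  fixes q :: "'a::field"
  assumes "\<And>k. k > 0 \<Longrightarrow> q ^ k \<noteq> 1"
  shows "q_binomial q m 0 = 1"
  using q_pochhammer_self_nonzero[OF assms] by (simp add: q_binomial_def)

lemma q_binomial_self:
  fixes q :: "'a::field"
  assumes "\<And>k. k > 0 \<Longrightarrow> q ^ k \<noteq> 1"
  shows "q_binomial q m m = 1"
  using q_pochhammer_self_nonzero[OF assms] by (simp add: q_binomial_def)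

lemma q_binomial_eq_0: "m < j \<Longrightarrow> q_binomial q m j = 0"
  by (simp add: q_binomial_def)

lemma
  fixes q :: "'a::field"
  assumes q: "\<And>k. k > 0 \<Longrightarrow> q ^ k \<noteq> 1" and "j \<le> m"
  shows q_pascal_1: "q_binomial q (Suc m) (Suc j)
                       = q_binomial q m (Suc j) + q ^ (m - j) * q_binomial q m j"
    and q_pascal_2: "q_binomial q (Suc m) (Suc j)
                       = q ^ Suc j * q_binomial q m (Suc j) + q_binomial q m j"
proof -
  consider "m = j" | d where "m = Suc (j + d)"
    using \<open>j \<le> m\<close> by (metis less_natE order_le_less)
  then have "q_binomial q (Suc m) (Suc j) = q_binomial q m (Suc j) + q ^ (m - j) * q_binomial q m j
    \<and> q_binomial q (Suc m) (Suc j) = q ^ Suc j * q_binomial q m (Suc j) + q_binomial q m j"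
  proof cases
    case 1
    then show ?thesis
      using q_binomial_self[OF q] by (simp add: q_binomial_eq_0)
  next
    case 2
    define A B C where "A = q_pochhammer q q m" and "B = q_pochhammer q q j"
      and "C = q_pochhammer q q d"
    define u v where "u = q ^ Suc j" and "v = q ^ Suc d"
    have nz: "B \<noteq> 0" "C \<noteq> 0" "1 - u \<noteq> 0" "1 - v \<noteq> 0"
      using q_pochhammer_self_nonzero[OF q] q[of "Suc j"] q[of "Suc d"]
      unfolding B_def C_def u_def v_def by auto
    have uv: "q ^ m * q = u * v"
      by (simp add: 2 u_def v_def power_add algebra_simps)
    have l: "q_binomial q (Suc m) (Suc j) = A * (1 - u * v) / (C * (1 - v) * (B * (1 - u)))"
      using 2 uv by (simp add: q_binomial_def q_pochhammer_Suc A_def B_def C_def u_def v_def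
          mult.commute)
    have r1: "q_binomial q m (Suc j) = A / (C * (B * (1 - u)))"
      using 2 by (simp add: q_binomial_def A_def B_def C_def u_def v_def
          q_pochhammer_Suc[of q q j] mult.commute)
    have r2: "q_binomial q m j = A / (C * (1 - v) * B)"
      using 2 by (simp add: q_binomial_def A_def B_def C_def u_def v_def Suc_diff_le
          q_pochhammer_Suc[of q q d] mult.commute)
    have md: "q ^ (m - j) = v"
      using 2 by (simp add: v_def Suc_diff_le)
    show ?thesis
      unfolding l r1 r2 md u_def[symmetric]
      using nz by (simp add: divide_simps) (simp add: algebra_simps)
  qed
  then show "q_binomial q (Suc m) (Suc j) = q_binomial q m (Suc j) + q ^ (m - j) * q_binomial q m j"
    and "q_binomial q (Suc m) (Suc j) = q ^ Suc j * q_binomial q m (Suc j) + q_binomial q m j"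
    by blast+
qed

section \<open>The coefficients of the q-Chebyshev polynomials\<close>

text \<open>
  The coefficient of \<open>s\<^sup>j x\<^sup>n\<^sup>-\<^sup>2\<^sup>j\<close> in \<open>U\<^sub>n\<close>, indexed by \<open>m = n - j\<close> instead of \<open>n\<close>; it vanishes for
  \<open>j > m\<close>, that is, for \<open>2j > n\<close>.
\<close>

definition cheb_coeff :: "'a::field \<Rightarrow> nat \<Rightarrow> nat \<Rightarrow> 'a" where
  "cheb_coeff q m j =
     q ^ (j\<^sup>2) * q_binomial q m j * (q_pochhammer (- q) q m / q_pochhammer (- q) q j)"

lemma cheb_coeff_eq_0: "m < j \<Longrightarrow> cheb_coeff q m j = 0"
  by (simp add: cheb_coeff_def q_binomial_eq_0)

lemma cheb_coeff_Suc_0: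
  fixes q :: "'a::field"
  assumes "\<And>k. k > 0 \<Longrightarrow> q ^ k \<noteq> 1"
  shows "cheb_coeff q (Suc m) 0 = (1 + q ^ Suc m) * cheb_coeff q m 0"
  using q_binomial_0[OF assms] by (simp add: cheb_coeff_def q_pochhammer_Suc algebra_simps)

lemma cheb_coeff_Suc_Suc:
  fixes q :: "'a::field"
  assumes q: "\<And>k. k > 0 \<Longrightarrow> q ^ k \<noteq> 1"
  shows "cheb_coeff q (Suc m) (Suc j)
           = (1 + q ^ (m + j + 2)) * cheb_coeff q m (Suc j) + q ^ (m + j + 1) * cheb_coeff q m j"
proof (cases "j \<le> m")
  case False
  then show ?thesis by (simp add: cheb_coeff_eq_0)
next
  case True
  define P where "P = q_pochhammer (- q) q m / q_pochhammer (- q) q (Suc j)"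
  define b0 b1 where "b0 = q_binomial q m j" and "b1 = q_binomial q m (Suc j)"
  have ratio: "q_pochhammer (- q) q m / q_pochhammer (- q) q j = (1 + q ^ Suc j) * P"
    using q_pochhammer_neg_nonzero[OF q, of j] q_pochhammer_neg_nonzero[OF q, of "Suc j"]
    by (simp add: P_def q_pochhammer_Suc mult.commute)
  have pascal: "(1 + q ^ Suc m) * q_binomial q (Suc m) (Suc j)
      = (1 + q ^ (m + j + 2)) * b1 + q ^ (m - j) * (1 + q ^ Suc j) * b0"
  proof -
    have "(1 + q ^ Suc m) * q_binomial q (Suc m) (Suc j)
        = (b1 + q ^ (m - j) * b0) + q ^ Suc m * (q ^ Suc j * b1 + b0)"
      using q_pascal_1[OF q True] q_pascal_2[OF q True]
      by (simp only: b0_def b1_def distrib_right mult_1_left)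
    moreover have "q ^ Suc m = q ^ (m - j) * q ^ Suc j"
      using True by (simp flip: power_add)
    moreover have "q ^ (m + j + 2) = q ^ Suc m * q ^ Suc j"
      by (simp flip: power_add)
    ultimately show ?thesis by (simp only: algebra_simps mult_1_left)
  qed
  have "cheb_coeff q (Suc m) (Suc j)
      = q ^ (Suc j)\<^sup>2 * P * ((1 + q ^ Suc m) * q_binomial q (Suc m) (Suc j))"
    by (simp add: cheb_coeff_def P_def q_pochhammer_Suc[of _ _ m] algebra_simps)
  also have "\<dots> = (1 + q ^ (m + j + 2)) * (q ^ (Suc j)\<^sup>2 * b1 * P)
      + q ^ (Suc j)\<^sup>2 * q ^ (m - j) * b0 * ((1 + q ^ Suc j) * P)"
    unfolding pascal by (simp only: algebra_simps)
  also have "q ^ (Suc j)\<^sup>2 * q ^ (m - j) = q ^ (m + j + 1) * q ^ j\<^sup>2"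
    using True by (simp add: power2_eq_square add_ac flip: power_add)
  finally show ?thesis
    unfolding cheb_coeff_def P_def[symmetric] ratio b0_def b1_def by (simp only: mult.assoc)
qed

section \<open>The explicit formula\<close>

lemma scalar_add: "scalar (a + b) = scalar a + scalar b"
  by (simp add: scalar_def)

lemma scalar_mult: "scalar (a * b) = scalar a * scalar b"
  by (simp add: scalar_def)

lemma scalar_0 [simp]: "scalar 0 = 0"
  by (simp add: scalar_def)

lemma scalar_1 [simp]: "scalar 1 = 1"
  by (simp add: scalar_def one_pCons)

lemma scalar_of_nat: "scalar (of_nat k) = of_nat k"
  by (induction k) (simp_all add: scalar_add)

text \<open>
  The \<open>j\<close>-th term of \<open>U\<^sub>n\<close>. For \<open>2j > n\<close>, where the exponent of \<open>x\<close> is truncated, the term is \<open>0\<close>.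
\<close>

definition cheb_term :: "complex \<Rightarrow> nat \<Rightarrow> nat \<Rightarrow> complex poly poly" where
  "cheb_term q n j = scalar (cheb_coeff q (n - j) j) * s_var ^ j * x_var ^ (n - 2 * j)"

lemma inc_q_cheb_U_eq_sum: "inc_q_cheb_U q n k = (\<Sum>j\<le>k. cheb_term q n j)"
  by (simp add: inc_q_cheb_U_def cheb_term_def cheb_coeff_def)

lemma cheb_term_eq_0: "n < 2 * j \<Longrightarrow> cheb_term q n j = 0"
  by (cases "j = 0") (auto simp: cheb_term_def cheb_coeff_eq_0)

lemma cheb_term_Suc_0:
  assumes "\<And>k. k > 0 \<Longrightarrow> q ^ k \<noteq> 1"
  shows "cheb_term q (Suc n) 0 = scalar (1 + q ^ Suc n) * x_var * cheb_term q n 0"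
  using cheb_coeff_Suc_0[OF assms, of n]
  by (simp add: cheb_term_def scalar_mult mult.assoc mult.left_commute)

lemma cheb_term_Suc_Suc:
  assumes q: "\<And>k. k > 0 \<Longrightarrow> q ^ k \<noteq> 1" and "j \<le> n"
  shows "cheb_term q (Suc (Suc n)) (Suc j)
           = scalar (1 + q ^ (n + 2)) * x_var * cheb_term q (Suc n) (Suc j)
             + scalar (q ^ (n + 1)) * s_var * cheb_term q n j"
proof -
  have c: "cheb_coeff q (Suc (n - j)) (Suc j)
      = (1 + q ^ (n + 2)) * cheb_coeff q (n - j) (Suc j) + q ^ (n + 1) * cheb_coeff q (n - j) j"
    using cheb_coeff_Suc_Suc[OF q, of "n - j" j] \<open>j \<le> n\<close> by simp
  \<comment> \<open>If the exponent of \<open>x\<close> on the right is truncated, then the coefficient vanishes.\<close>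
  have x: "scalar (cheb_coeff q (n - j) (Suc j)) * x_var ^ (n - 2 * j)
      = scalar (cheb_coeff q (n - j) (Suc j)) * (x_var * x_var ^ (Suc n - 2 * Suc j))"
  proof (cases "2 * Suc j \<le> Suc n")
    case True
    then have "n - 2 * j = Suc (Suc n - 2 * Suc j)" by simp
    then show ?thesis by (simp only: power_Suc)
  next
    case False
    then show ?thesis by (simp add: cheb_coeff_eq_0)
  qed
  have "cheb_term q (Suc (Suc n)) (Suc j)
      = scalar (cheb_coeff q (Suc (n - j)) (Suc j)) * s_var ^ Suc j * x_var ^ (n - 2 * j)"
    using \<open>j \<le> n\<close> by (simp add: cheb_term_def Suc_diff_le)
  also have "\<dots> = scalar (1 + q ^ (n + 2)) * s_var ^ Suc j
        * (scalar (cheb_coeff q (n - j) (Suc j)) * x_var ^ (n - 2 * j))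
      + scalar (q ^ (n + 1)) * s_var
        * (scalar (cheb_coeff q (n - j) j) * s_var ^ j * x_var ^ (n - 2 * j))"
    unfolding c scalar_add[of "_ * _"] scalar_mult power_Suc by (simp only: algebra_simps)
  also have "\<dots> = scalar (1 + q ^ (n + 2)) * x_var * cheb_term q (Suc n) (Suc j)
      + scalar (q ^ (n + 1)) * s_var * cheb_term q n j"
    unfolding x cheb_term_def diff_Suc_Suc by (simp only: mult_ac)
  finally show ?thesis .
qed

lemma q_cheb_U_eq_sum:
  assumes q: "\<And>k. k > 0 \<Longrightarrow> q ^ k \<noteq> 1"
  shows "q_cheb_U q n = (\<Sum>j\<le>n. cheb_term q n j)"
proof (induction n rule: induct_nat_012)
  case 0
  show ?case
    using q_binomial_0[OF q] by (simp add: cheb_term_def cheb_coeff_def)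
next
  case 1
  show ?case
    using q_binomial_0[OF q]
    by (simp add: cheb_term_eq_0 cheb_term_Suc_0[OF q]) (simp add: cheb_term_def cheb_coeff_def)
next
  case (ge2 n)
  let ?a = "scalar (1 + q ^ (n + 2)) * x_var" and ?b = "scalar (q ^ (n + 1)) * s_var"
  have "(\<Sum>j\<le>Suc (Suc n). cheb_term q (Suc (Suc n)) j)
      = (\<Sum>j\<le>Suc n. cheb_term q (Suc (Suc n)) j)"
    by (simp add: cheb_term_eq_0)
  also have "\<dots> = cheb_term q (Suc (Suc n)) 0 + (\<Sum>j\<le>n. cheb_term q (Suc (Suc n)) (Suc j))"
    by (rule sum.atMost_Suc_shift)
  also have "\<dots> = ?a * cheb_term q (Suc n) 0
      + (\<Sum>j\<le>n. ?a * cheb_term q (Suc n) (Suc j) + ?b * cheb_term q n j)"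
    using cheb_term_Suc_Suc[OF q] cheb_term_Suc_0[OF q, of "Suc n"] by simp
  also have "\<dots> = ?a * (\<Sum>j\<le>Suc n. cheb_term q (Suc n) j) + ?b * (\<Sum>j\<le>n. cheb_term q n j)"
    unfolding sum.atMost_Suc_shift sum.distrib sum_distrib_left[symmetric]
    by (simp only: distrib_left add.assoc)
  finally show ?case
    using ge2 by simp
qed

lemma q_cheb_U_eq_inc:
  assumes "\<And>k. k > 0 \<Longrightarrow> q ^ k \<noteq> 1"
  shows "q_cheb_U q n = inc_q_cheb_U q n (n div 2)"
proof -
  have "q_cheb_U q n = (\<Sum>j\<le>n. cheb_term q n j)"
    by (rule q_cheb_U_eq_sum) (rule assms)
  also have "\<dots> = (\<Sum>j\<le>n div 2. cheb_term q n j)"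
    by (rule sum.mono_neutral_right) (auto intro!: cheb_term_eq_0)
  finally show ?thesis by (simp add: inc_q_cheb_U_eq_sum)
qed

section \<open>Comparing multiplicities\<close>

lemma pderiv_sum: "pderiv (\<Sum>i\<in>A. f i) = (\<Sum>i\<in>A. pderiv (f i))"
  by (induction A rule: infinite_finite_induct) (simp_all add: pderiv_add)

lemma x_var_mult_pderiv_cheb_term:
  "x_var * pderiv (cheb_term q n j) = scalar (of_nat (n - 2 * j)) * cheb_term q n j"
proof -
  have "pderiv (scalar c * s_var ^ j) = 0" for c
    by (simp add: scalar_def s_var_def pderiv_smult pderiv_power pderiv_pCons)
  moreover have "x_var * pderiv (x_var ^ k) = scalar (of_nat k) * x_var ^ k" for k
  proof (cases k)
    case (Suc l)
    have "pderiv x_var = 1"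
      by (simp add: x_var_def pderiv_pCons)
    moreover have "scalar (of_nat k) * p = smult (of_nat k) p" for p
      by (simp add: scalar_def of_nat_poly)
    ultimately show ?thesis
      using Suc by (simp add: pderiv_power_Suc del: of_nat_Suc power_Suc) simp
  qed simp
  ultimately show ?thesis
    by (simp add: cheb_term_def pderiv_mult mult.left_commute)
qed

lemma sum_sum_atMost:
  fixes f :: "nat \<Rightarrow> 'a::comm_semiring_1"
  shows "(\<Sum>k=0..N. \<Sum>j\<le>k. f j) = (\<Sum>j\<le>N. of_nat (Suc N - j) * f j)"
proof (induction N)
  case (Suc N)
  have "(\<Sum>j\<le>N. of_nat (Suc (Suc N) - j) * f j) = (\<Sum>j\<le>N. of_nat (Suc N - j) * f j + f j)"
    by (rule sum.cong) (simp_all add: Suc_diff_le algebra_simps)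
  then show ?case
    using Suc by (simp add: sum.distrib add.assoc)
qed simp

theorem theorem8:
  fixes q :: complex and n :: nat
  assumes "0 < cmod q" and "cmod q < 1"
  shows "(\<Sum>k = 0..n div 2. inc_q_cheb_U q n k) =
           scalar (of_nat (n div 2) - of_nat n / 2 + 1) * q_cheb_U q n
           + scalar (1 / 2) * x_var * pderiv (q_cheb_U q n)"
proof -
  let ?N = "n div 2" and ?c = "of_nat (n div 2) - of_nat n / 2 + 1 :: complex"
  have q: "q ^ k \<noteq> 1" if "k > 0" for k
  proof
    assume "q ^ k = 1"
    then have "cmod q ^ k = 1" by (metis norm_one norm_power)
    then show False
      using power_Suc_less_one[of "cmod q" "k - 1"] assms that by simp
  qed
  have U: "q_cheb_U q n = (\<Sum>j\<le>?N. cheb_term q n j)"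
    using q_cheb_U_eq_inc[OF q] by (simp add: inc_q_cheb_U_eq_sum)
  have mult: "scalar (of_nat (Suc ?N - j)) * t
      = scalar ?c * t + scalar (1 / 2) * (scalar (of_nat (n - 2 * j)) * t)" if "j \<le> ?N" for j t
  proof -
    have "2 * j \<le> n" using that by simp
    then have "of_nat (Suc ?N - j) = ?c + 1 / 2 * of_nat (n - 2 * j)"
      using that by (simp add: of_nat_diff field_simps)
    then show ?thesis
      by (simp only: scalar_add[of ?c] scalar_mult distrib_right mult.assoc)
  qed
  have "(\<Sum>k=0..?N. inc_q_cheb_U q n k)
      = (\<Sum>j\<le>?N. scalar (of_nat (Suc ?N - j)) * cheb_term q n j)"
    unfolding inc_q_cheb_U_eq_sum sum_sum_atMost scalar_of_nat ..
  also have "\<dots> = (\<Sum>j\<le>?N. scalar ?c * cheb_term q n j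
      + scalar (1 / 2) * (x_var * pderiv (cheb_term q n j)))"
    by (rule sum.cong) (simp_all only: atMost_iff mult x_var_mult_pderiv_cheb_term)
  also have "\<dots> = scalar ?c * q_cheb_U q n + scalar (1 / 2) * x_var * pderiv (q_cheb_U q n)"
    unfolding U pderiv_sum sum.distrib sum_distrib_left mult.assoc ..
  finally show ?thesis .
qed

end
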